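(* Let $g(t):=|t|$ for all $t\in\mathbb{R}$, and for every $\sigma>0$ let $\phi_\sigma:=K_\sigma*g$, i.e. $$\phi_\sigma(t) = \frac{1}{\sqrt{2\pi\sigma^2}}\int_{-\infty}^{\infty} |t-s|\exp\left(-\frac{s^2}{2\sigma^2}\right)\,\mathrm{d}s,\qquad t\in\mathbb{R}.$$ Then $$\lim_{\sigma\to 0}\|\phi_\sigma-g\|_{L^1}=0.$$
   Context: For $\sigma>0$, $K_\sigma:\mathbb{R}\to\mathbb{R}$ is the Gaussian $K_\sigma(t)=\frac{1}{\sqrt{2\pi\sigma^2}}\exp\left(-\frac{t^2}{2\sigma^2}\right)$. The norm is $\|f\|_{L^1}=\int_{-\infty}^{\infty}|f(t)|\,\mathrm{d}t$, the $L^1$ norm on $\mathbb{R}$. The limit is over $\sigma>0$, $\sigma\to0$. *)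

theory Defs
  imports "HOL-Probability.Probability"
begin

abbreviation gaussian_kernel :: "real \<Rightarrow> real \<Rightarrow> real" where
  "gaussian_kernel \<sigma> \<equiv> normal_density 0 \<sigma>"

definition fun_convolution :: "(real \<Rightarrow> real) \<Rightarrow> (real \<Rightarrow> real) \<Rightarrow> real \<Rightarrow> real" where
  "fun_convolution f h t = (LINT s|lborel. f s * h (t - s))"

text \<open>
  The norm takes values in the extended nonnegative reals, so that a non-integrable function has
  norm \<open>\<infinity>\<close>; the Bochner integral would give it the value 0.
\<close>

definition L1_norm :: "(real \<Rightarrow> real) \<Rightarrow> ennreal" where
  "L1_norm f = (\<integral>\<^sup>+ t. ennreal \<bar>f t\<bar> \<partial>lborel)"

lemma gaussian_kernel_eq:
  "gaussian_kernel \<sigma> t = 1 / sqrt (2 * pi * \<sigma>\<^sup>2) * exp (- (t\<^sup>2 / (2 * \<sigma>\<^sup>2)))"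
  by (simp add: normal_density_def)

lemma fun_convolution_gaussian_kernel_abs:
  "fun_convolution (gaussian_kernel \<sigma>) abs t =
    1 / sqrt (2 * pi * \<sigma>\<^sup>2) * (LINT s|lborel. \<bar>t - s\<bar> * exp (- (s\<^sup>2 / (2 * \<sigma>\<^sup>2))))"
  unfolding fun_convolution_def gaussian_kernel_eq
  by (subst integral_mult_right_zero[symmetric]) (simp only: mult_ac)

text \<open>The integral defining the convolution converges, so it is not a default value.\<close>

lemma integrable_gaussian_kernel_abs:
  assumes "\<sigma> > 0"
  shows "integrable lborel (\<lambda>s. gaussian_kernel \<sigma> s * \<bar>t - s\<bar>)"
proof -
  have "integrable lborel (\<lambda>s. t * gaussian_kernel \<sigma> s - gaussian_kernel \<sigma> s * (s - 0) ^ 1)"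
    using assms by (intro Bochner_Integration.integrable_diff integrable_mult_right
        integrable_normal_density integrable_normal_moment) auto
  then have "integrable lborel
      (\<lambda>s. \<bar>t * gaussian_kernel \<sigma> s - gaussian_kernel \<sigma> s * (s - 0) ^ 1\<bar>)"
    by (rule integrable_abs)
  moreover have "\<bar>t * gaussian_kernel \<sigma> s - gaussian_kernel \<sigma> s * (s - 0) ^ 1\<bar>
      = gaussian_kernel \<sigma> s * \<bar>t - s\<bar>" for s
  proof -
    have "t * gaussian_kernel \<sigma> s - gaussian_kernel \<sigma> s * (s - 0) ^ 1
        = gaussian_kernel \<sigma> s * (t - s)"
      by (simp add: algebra_simps)
    then show ?thesis
      by (simp only: abs_mult abs_of_nonneg[OF normal_density_nonneg])
  qed
  ultimately show ?thesis
    by simp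
qed

end

theory Submission
  imports Defs
begin

text \<open>
  The Gaussian is a probability density with mean 0, so convolving with it fixes every affine
  function. Comparing the absolute value with a supporting line of its graph at \<open>t\<close>
  therefore turns \<open>\<phi>\<^sub>\<sigma> t - \<bar>t\<bar>\<close> into the Gaussian average over \<open>s\<close> of the
  height \<open>kink_gap t s\<close> of the graph above that line, measured at \<open>t - s\<close>
  (\<open>gaussian_smoothing_abs_minus_abs\<close>). This height is nonnegative by convexity, and vanishes
  unless the kink at 0 lies between \<open>t\<close> and \<open>t - s\<close>. So, for fixed \<open>s\<close>, only the
  \<open>t\<close> with \<open>\<bar>t\<bar> \<le> \<bar>s\<bar>\<close> matter, and the integral over \<open>t\<close> is the area
  \<open>s\<^sup>2\<close> of a triangle (\<open>nn_integral_kink_gap\<close>).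

  Since the integrand is nonnegative, Tonelli's theorem allows the integration over \<open>t\<close> to be
  done first, and the \<open>L\<^sup>1\<close> distance is exactly the second moment \<open>\<sigma>\<^sup>2\<close> of the
  kernel (\<open>L1_norm_gaussian_smoothing_abs\<close>), which tends to 0 with \<open>\<sigma>\<close>.
\<close>

text \<open>
  The supporting line at \<open>t\<close> with slope \<open>c\<close> has the value \<open>\<bar>t\<bar> - c * s\<close> at \<open>t - s\<close>.
  At \<open>t = 0\<close> any slope in \<open>[-1, 1]\<close> gives a supporting line; the slope 1 is chosen there.
\<close>

definition kink_gap :: "real \<Rightarrow> real \<Rightarrow> real" where
  "kink_gap t s = \<bar>t - s\<bar> - \<bar>t\<bar> + (if 0 \<le> t then s else - s)"

lemma kink_gap_nonneg: "0 \<le> kink_gap t s"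
  by (auto simp: kink_gap_def abs_real_def)

lemma borel_measurable_kink_gap [measurable]:
  "(\<lambda>(t, s). kink_gap t s) \<in> borel_measurable (borel \<Otimes>\<^sub>M borel)"
  unfolding kink_gap_def by measurable

text \<open>
  The total mass 1 of the kernel accounts for the term \<open>\<bar>t\<bar>\<close>, and its vanishing mean removes
  the linear part of the supporting line. Unlike the signed difference
  \<open>\<bar>t - s\<bar> - \<bar>t\<bar>\<close>, the new integrand is nonnegative, so the order of integration can be
  exchanged later without losing cancellation.
\<close>

lemma gaussian_smoothing_abs_minus_abs:
  assumes "\<sigma> > 0"
  shows "integrable lborel (\<lambda>s. gaussian_kernel \<sigma> s * kink_gap t s)"
    and "fun_convolution (gaussian_kernel \<sigma>) abs t - \<bar>t\<bar>
      = (LINT s|lborel. gaussian_kernel \<sigma> s * kink_gap t s)"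
proof -
  define c :: real where "c = (if 0 \<le> t then 1 else - 1)"
  have split: "gaussian_kernel \<sigma> s * kink_gap t s = gaussian_kernel \<sigma> s * \<bar>t - s\<bar>
      - \<bar>t\<bar> * gaussian_kernel \<sigma> s + c * (gaussian_kernel \<sigma> s * s)" for s
    by (simp add: kink_gap_def c_def algebra_simps)
  have mean: "has_bochner_integral lborel (\<lambda>s. gaussian_kernel \<sigma> s * s) 0"
    using normal_moment_odd[OF assms, of 0 0] by simp
  have mass: "has_bochner_integral lborel (gaussian_kernel \<sigma>) 1"
    using assms by (simp add: has_bochner_integral_iff)
  have "has_bochner_integral lborel
      (\<lambda>s. gaussian_kernel \<sigma> s * \<bar>t - s\<bar>) (fun_convolution (gaussian_kernel \<sigma>) abs t)"
    using integrable_gaussian_kernel_abs[OF assms]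
    by (simp add: has_bochner_integral_iff fun_convolution_def)
  then have "has_bochner_integral lborel (\<lambda>s. gaussian_kernel \<sigma> s * kink_gap t s)
      (fun_convolution (gaussian_kernel \<sigma>) abs t - \<bar>t\<bar> * 1 + c * 0)"
    unfolding split
    by (intro has_bochner_integral_add has_bochner_integral_diff
        has_bochner_integral_mult_right mean mass)
  then show "integrable lborel (\<lambda>s. gaussian_kernel \<sigma> s * kink_gap t s)"
    and "fun_convolution (gaussian_kernel \<sigma>) abs t - \<bar>t\<bar>
      = (LINT s|lborel. gaussian_kernel \<sigma> s * kink_gap t s)"
    by (simp_all add: has_bochner_integral_iff)
qed

text \<open>
  As a function of \<open>t\<close>, the gap is a linear ramp of slope \<open>\<plusminus>2\<close> on the interval between
  0 and \<open>s\<close> and vanishes elsewhere, up to its value at the single point 0.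
\<close>

lemma nn_integral_kink_gap:
  "(\<integral>\<^sup>+ t. ennreal (kink_gap t s) \<partial>lborel) = ennreal (s\<^sup>2)"
proof (cases "0 \<le> s")
  case True
  have "(\<integral>\<^sup>+ t. ennreal (kink_gap t s) \<partial>lborel)
      = (\<integral>\<^sup>+ t. ennreal (2 * (s - t)) * indicator {0..s} t \<partial>lborel)"
    using True by (intro nn_integral_cong) (auto simp: kink_gap_def indicator_def)
  also have "\<dots> = ennreal (- (s - s)\<^sup>2 - (- (s - 0)\<^sup>2))"
    using True
    by (intro nn_integral_FTC_Icc[where F = "\<lambda>t. - (s - t)\<^sup>2"])
       (auto intro!: derivative_eq_intros)
  finally show ?thesis
    by simp
next
  case False
  have "(\<integral>\<^sup>+ t. ennreal (kink_gap t s) \<partial>lborel)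
      = (\<integral>\<^sup>+ t. ennreal (2 * (t - s)) * indicator {s..0} t \<partial>lborel)"
  proof (rule nn_integral_cong_AE)
    show "AE t in lborel. ennreal (kink_gap t s) = ennreal (2 * (t - s)) * indicator {s..0} t"
      using AE_lborel_singleton[of "0::real"]
      by eventually_elim (use False in \<open>auto simp: kink_gap_def indicator_def\<close>)
  qed
  also have "\<dots> = ennreal ((0 - s)\<^sup>2 - (s - s)\<^sup>2)"
    using False
    by (intro nn_integral_FTC_Icc[where F = "\<lambda>t. (t - s)\<^sup>2"])
       (auto intro!: derivative_eq_intros)
  finally show ?thesis
    by simp
qed

lemma nn_integral_gaussian_kernel_second_moment:
  assumes "\<sigma> > 0"
  shows "(\<integral>\<^sup>+ s. ennreal (gaussian_kernel \<sigma> s * s\<^sup>2) \<partial>lborel) = ennreal (\<sigma>\<^sup>2)"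
proof -
  have "has_bochner_integral lborel (\<lambda>s. gaussian_kernel \<sigma> s * s\<^sup>2) (\<sigma>\<^sup>2)"
    using normal_moment_even[OF assms, of 0 1] by simp
  then show ?thesis
    by (subst nn_integral_eq_integral) (auto simp: has_bochner_integral_iff)
qed

theorem L1_norm_gaussian_smoothing_abs:
  assumes "\<sigma> > 0"
  shows "L1_norm (\<lambda>t. fun_convolution (gaussian_kernel \<sigma>) abs t - \<bar>t\<bar>) = ennreal (\<sigma>\<^sup>2)"
proof -
  have "L1_norm (\<lambda>t. fun_convolution (gaussian_kernel \<sigma>) abs t - \<bar>t\<bar>)
      = (\<integral>\<^sup>+ t. ennreal (LINT s|lborel. gaussian_kernel \<sigma> s * kink_gap t s) \<partial>lborel)"
    unfolding L1_norm_def gaussian_smoothing_abs_minus_abs(2)[OF assms]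
    by (simp add: kink_gap_nonneg)
  also have "\<dots> = (\<integral>\<^sup>+ t. \<integral>\<^sup>+ s. ennreal (gaussian_kernel \<sigma> s * kink_gap t s) \<partial>lborel \<partial>lborel)"
    by (intro nn_integral_cong nn_integral_eq_integral[symmetric]
        gaussian_smoothing_abs_minus_abs(1) assms) (simp add: kink_gap_nonneg)
  also have "\<dots> = (\<integral>\<^sup>+ s. \<integral>\<^sup>+ t. ennreal (gaussian_kernel \<sigma> s * kink_gap t s) \<partial>lborel \<partial>lborel)"
    by (rule lborel_pair.Fubini') measurable
  also have "\<dots> = (\<integral>\<^sup>+ s. ennreal (gaussian_kernel \<sigma> s * s\<^sup>2) \<partial>lborel)"
    by (simp add: ennreal_mult kink_gap_nonneg nn_integral_cmult nn_integral_kink_gap)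
  also have "\<dots> = ennreal (\<sigma>\<^sup>2)"
    using assms by (rule nn_integral_gaussian_kernel_second_moment)
  finally show ?thesis .
qed

theorem proposition2p6:
  fixes g :: "real \<Rightarrow> real" and \<phi> :: "real \<Rightarrow> real \<Rightarrow> real"
  assumes "\<And>t. g t = \<bar>t\<bar>"
    and "\<And>\<sigma> t. \<sigma> > 0 \<Longrightarrow> \<phi> \<sigma> t = fun_convolution (gaussian_kernel \<sigma>) g t"
  shows "((\<lambda>\<sigma>. L1_norm (\<lambda>t. \<phi> \<sigma> t - g t)) \<longlongrightarrow> 0) (at_right 0)"
proof -
  have g: "g = abs"
    using assms(1) by auto
  have "\<forall>\<^sub>F \<sigma> in at_right 0. ennreal (\<sigma>\<^sup>2) = L1_norm (\<lambda>t. \<phi> \<sigma> t - g t)"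
    using eventually_at_right_less[of 0]
    by eventually_elim (simp add: assms(2) g L1_norm_gaussian_smoothing_abs)
  moreover have "((\<lambda>\<sigma>::real. ennreal (\<sigma>\<^sup>2)) \<longlongrightarrow> ennreal (0\<^sup>2)) (at_right 0)"
    by (intro tendsto_intros)
  ultimately show ?thesis
    using Lim_transform_eventually by fastforce
qed

end
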